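(* Let $f=(f_n)_{n\ge 1}$ be a function which assigns to each $n$ and each distance vector $(d_1,\ldots,d_n)$ a real number $f(d_1,\ldots,d_n)$, and suppose that $f$ is a valid lower bound for the parallel token swapping problem, i.e. $OPT(G,C)\ge f(d_1(C),\ldots,d_n(C))$ for every $n$, every connected graph $G$ on the vertex set $\{1,\ldots,n\}$ and every configuration $C$ on $G$. Then the stretch factor of this lower bound is $\Omega(n)$ for graphs on $n$ vertices; that is, there are a constant $c>0$ and an integer $n_0$ such that for every $n\ge n_0$ $$\sup_{(G,C)}\frac{OPT(G,C)}{f(d_1(C),\ldots,d_n(C))}\ \ge\ c\,n ,$$ where the supremum is over all instances $(G,C)$ with $G$ a connected graph on $\{1,\ldots,n\}$ and $C$ a configuration on $G$ with $C\ne Id$.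
   Context: Let $G=(V,E)$ be a finite connected undirected simple graph. The token set $T$ is a copy of $V$. A configuration is a bijection $C:V\to T$ ($C(v)$ is the token lying on vertex $v$); $Id$ is the canonical identity bijection. A matching $M\subseteq E$ routes a configuration $C$ to the configuration $MC$ given by $MC(v)=C(w)$ if $(v,w)\in M$, and $MC(v)=C(v)$ if $v$ is not covered by $M$. The parallel token swapping problem: given $(G,C)$, find a sequence of matchings $(M_1,\ldots,M_k)$ of $G$ with $k$ minimum such that $M_k\cdots M_1C=Id$. The minimum $k$ is denoted $OPT(G,C)$. With $V=T=\{1,\ldots,n\}$, $d_t(C)$ is the graph (geodesic) distance in $G$ between $C^{-1}(t)$ and $Id^{-1}(t)$, for each token $t$. The function $f$ depends only on the distance vector and not otherwise on $G$ or $C$. A ratio $OPT/f$ with $OPT>0$ and $f\le 0$ is interpreted as $+\infty$. *)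

theory Defs
  imports
    "HOL-Library.Extended_Real"
    "HOL-Library.Disjoint_Sets"
    "HOL-Combinatorics.Permutations"
begin

text \<open>A simple graph is given by a vertex set and a set of two-element sets of vertices.\<close>

definition simple_graph :: "'a set \<Rightarrow> 'a set set \<Rightarrow> bool" where
  "simple_graph V E \<longleftrightarrow> finite V \<and> (\<forall>e\<in>E. e \<subseteq> V \<and> card e = 2)"

definition adj_rel :: "'a set set \<Rightarrow> 'a rel" where
  "adj_rel E = {(u, v). {u, v} \<in> E}"

definition connected_graph :: "'a set \<Rightarrow> 'a set set \<Rightarrow> bool" where
  "connected_graph V E \<longleftrightarrow>
     simple_graph V E \<and> V \<noteq> {} \<and> (\<forall>u\<in>V. \<forall>v\<in>V. (u, v) \<in> (adj_rel E)\<^sup>*)"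

text \<open>The least length of a walk; only meaningful if \<open>v\<close> is reachable from \<open>u\<close>.\<close>

definition graph_dist :: "'a set set \<Rightarrow> 'a \<Rightarrow> 'a \<Rightarrow> nat" where
  "graph_dist E u v = (LEAST k. (u, v) \<in> adj_rel E ^^ k)"

definition matching :: "'a set set \<Rightarrow> 'a set set \<Rightarrow> bool" where
  "matching E M \<longleftrightarrow> M \<subseteq> E \<and> disjoint M"

text \<open>
  The token set is the vertex set itself. A configuration on \<open>V\<close> is a function \<open>C\<close> with
  \<open>C permutes V\<close>, which represents each bijection from \<open>V\<close> to \<open>V\<close> exactly once; the token
  on vertex \<open>v\<close> is \<open>C v\<close>, and the identity configuration is \<open>id\<close>.
\<close>

definition apply_matching :: "'a set set \<Rightarrow> ('a \<Rightarrow> 'a) \<Rightarrow> 'a \<Rightarrow> 'a" where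
  "apply_matching M C v = (if v \<in> \<Union>M then C (THE w. {v, w} \<in> M) else C v)"

text \<open>The head of the list is the matching that is applied first.\<close>

definition routes :: "'a set set \<Rightarrow> ('a \<Rightarrow> 'a) \<Rightarrow> 'a set set list \<Rightarrow> bool" where
  "routes E C Ms \<longleftrightarrow> (\<forall>M\<in>set Ms. matching E M) \<and> fold apply_matching Ms C = id"

text \<open>On a connected graph every configuration can be routed, so the minimum exists.\<close>

definition OPT :: "'a set set \<Rightarrow> ('a \<Rightarrow> 'a) \<Rightarrow> nat" where
  "OPT E C = (LEAST k. \<exists>Ms. length Ms = k \<and> routes E C Ms)"

definition token_dist :: "'a set set \<Rightarrow> ('a \<Rightarrow> 'a) \<Rightarrow> 'a \<Rightarrow> nat" where
  "token_dist E C t = graph_dist E (inv C t) t"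

definition instances :: "nat \<Rightarrow> (nat set set \<times> (nat \<Rightarrow> nat)) set" where
  "instances n = {(E, C). connected_graph {1..n} E \<and> C permutes {1..n}}"

definition dist_vector :: "nat \<Rightarrow> nat set set \<Rightarrow> (nat \<Rightarrow> nat) \<Rightarrow> nat list" where
  "dist_vector n E C = map (token_dist E C) [1..<Suc n]"

definition valid_lower_bound :: "(nat \<Rightarrow> nat list \<Rightarrow> real) \<Rightarrow> bool" where
  "valid_lower_bound f \<longleftrightarrow>
     (\<forall>n\<ge>1. \<forall>(E, C)\<in>instances n. f n (dist_vector n E C) \<le> real (OPT E C))"

text \<open>
  Applied only to a positive optimum \<open>k\<close>; a lower bound \<open>b \<le> 0\<close> then gives an infinite ratio.
\<close>

definition ratio :: "nat \<Rightarrow> real \<Rightarrow> ereal" where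
  "ratio k b = (if b \<le> 0 then \<infinity> else ereal (real k / b))"

definition stretch_factor :: "(nat \<Rightarrow> nat list \<Rightarrow> real) \<Rightarrow> nat \<Rightarrow> ereal" where
  "stretch_factor f n =
     (SUP (E, C) \<in> {(E, C) \<in> instances n. C \<noteq> id}. ratio (OPT E C) (f n (dist_vector n E C)))"

end

theory Submission
  imports Defs
begin

text \<open>
  The stretch is witnessed by a single configuration on two graphs. Pair up most of the vertices by
  \<open>x \<leftrightarrow> x XOR 2\<close>. On the complete bipartite graph between even and odd
  vertices, as well as on a star whose centre is a fixed point, every moved token has distance 2, so
  \<open>f\<close> takes the same value on both instances. On the bipartite graph this involution is the product
  of the matchings \<open>x \<leftrightarrow> x XOR 1\<close> and \<open>x \<leftrightarrow> x XOR 3\<close>, which forces \<open>f \<le> 2\<close>. A matching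
  of the star has at most one edge and so brings at most two tokens home, hence the star needs
  linearly many steps.
\<close>

subsection \<open>Matchings as involutions\<close>

text \<open>Encodes a matching by the map that exchanges the endpoints of its edges, so that
  applying matchings becomes composition. Fixed points are left out because they would give
  singletons instead of edges.\<close>

definition involution_matching :: "('a \<Rightarrow> 'a) \<Rightarrow> 'a set set" where
  "involution_matching \<sigma> = {{x, \<sigma> x} | x. \<sigma> x \<noteq> x}"

lemma matching_involution_matching:
  assumes "\<And>x. \<sigma> (\<sigma> x) = x" and "\<And>x. \<sigma> x \<noteq> x \<Longrightarrow> {x, \<sigma> x} \<in> E"
  shows "matching E (involution_matching \<sigma>)"
  unfolding matching_def involution_matching_def
proof (intro conjI disjointI)
  show "{{x, \<sigma> x} | x. \<sigma> x \<noteq> x} \<subseteq> E"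
    using assms(2) by blast
next
  fix e e'
  assume "e \<in> {{x, \<sigma> x} | x. \<sigma> x \<noteq> x}" "e' \<in> {{x, \<sigma> x} | x. \<sigma> x \<noteq> x}" "e \<noteq> e'"
  then obtain x y where xy: "e = {x, \<sigma> x}" "e' = {y, \<sigma> y}" by blast
  \<comment> \<open>A shared vertex \<open>z\<close> determines the edge, since the other endpoint
    must be \<open>\<sigma> z\<close>.\<close>
  have "e = {z, \<sigma> z}" "e' = {z, \<sigma> z}" if "z \<in> e" "z \<in> e'" for z
    using xy that assms(1) by (metis doubleton_eq_iff empty_iff insert_iff)+
  with \<open>e \<noteq> e'\<close> show "e \<inter> e' = {}" by blast
qed

lemma apply_involution_matching:
  assumes "\<And>x. \<sigma> (\<sigma> x) = x"
  shows "apply_matching (involution_matching \<sigma>) C = C \<circ> \<sigma>"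
proof
  fix v
  show "apply_matching (involution_matching \<sigma>) C v = (C \<circ> \<sigma>) v"
  proof (cases "\<sigma> v = v")
    case True
    then have "v \<notin> \<Union>(involution_matching \<sigma>)"
      using assms by (auto simp: involution_matching_def)
    then show ?thesis using True by (simp add: apply_matching_def)
  next
    case False
    have "(THE w. {v, w} \<in> involution_matching \<sigma>) = \<sigma> v"
    proof (rule the_equality)
      show "{v, \<sigma> v} \<in> involution_matching \<sigma>"
        using False by (auto simp: involution_matching_def)
    next
      fix w assume "{v, w} \<in> involution_matching \<sigma>"
      then obtain x where "{v, w} = {x, \<sigma> x}" "\<sigma> x \<noteq> x"
        by (auto simp: involution_matching_def)
      then show "w = \<sigma> v"
        using assms by (metis doubleton_eq_iff)
    qed
    moreover have "v \<in> \<Union>(involution_matching \<sigma>)"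
      using False by (auto simp: involution_matching_def)
    ultimately show ?thesis by (simp add: apply_matching_def)
  qed
qed

subsection \<open>Routability on connected graphs\<close>

lemma routes_Cons:
  "routes E C (M # Ms) \<longleftrightarrow> matching E M \<and> routes E (apply_matching M C) Ms"
  by (auto simp: routes_def)

lemma routable_edge:
  assumes "{a, b} \<in> E" and "\<exists>Ms. routes E (C \<circ> transpose a b) Ms"
  shows "\<exists>Ms. routes E C Ms"
proof -
  obtain Ms where "routes E (C \<circ> transpose a b) Ms" using assms(2) by blast
  moreover have "matching E (involution_matching (transpose a b))"
    using assms(1)
    by (intro matching_involution_matching)
       (auto simp: transpose_def insert_commute split: if_splits)
  ultimately have "routes E C (involution_matching (transpose a b) # Ms)"
    by (simp add: routes_Cons apply_involution_matching)
  then show ?thesis by blast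
qed

text \<open>A swap along a walk reduces to swaps along its edges, by induction on the walk.\<close>

lemma routable_transpose:
  assumes "(a, b) \<in> (adj_rel E)\<^sup>*" and "\<exists>Ms. routes E (C \<circ> transpose a b) Ms"
  shows "\<exists>Ms. routes E C Ms"
  using assms
proof (induction arbitrary: C rule: rtrancl_induct)
  case base
  then show ?case by simp
next
  case (step b c)
  have bc: "{b, c} \<in> E" using step.hyps by (simp add: adj_rel_def)
  consider "a = c" | "a = b" | "b = c" | "a \<noteq> b" "a \<noteq> c" "b \<noteq> c" by blast
  then show ?case
  proof cases
    case 1
    then show ?thesis using step.prems by simp
  next
    case 2
    show ?thesis using step.prems unfolding 2 by (rule routable_edge[OF bc])
  next
    case 3
    show ?thesis using step.prems unfolding 3[symmetric] by (rule step.IH)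
  next
    case 4
    \<comment> \<open>Conjugating by the last edge of the walk turns the distant swap into one
      covered by the induction hypothesis, flanked by two edge swaps.\<close>
    then have "transpose a c = transpose b c \<circ> transpose a b \<circ> transpose b c"
      by (auto simp: fun_eq_iff transpose_def)
    then have "\<exists>Ms. routes E (C \<circ> transpose b c \<circ> transpose a b \<circ> transpose b c) Ms"
      using step.prems by (simp only: comp_assoc)
    then have "\<exists>Ms. routes E (C \<circ> transpose b c \<circ> transpose a b) Ms"
      by (rule routable_edge[OF bc])
    then have "\<exists>Ms. routes E (C \<circ> transpose b c) Ms"
      by (rule step.IH)
    then show ?thesis by (rule routable_edge[OF bc])
  qed
qed

text \<open>Every permutation of a finite set is a product of transpositions, and each can be peeled
  off on the right. This is what makes the \<open>LEAST\<close> in \<open>OPT\<close> an attained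
  minimum.\<close>

lemma routable_connected:
  assumes "connected_graph V E" and "C permutes V"
  shows "\<exists>Ms. routes E C Ms"
proof -
  have fin: "finite V" using assms(1) by (simp add: connected_graph_def simple_graph_def)
  from fin assms(2) show ?thesis
  proof (induction rule: permutes_rev_induct)
    case id
    have "routes E id []" by (simp add: routes_def)
    then show ?case by blast
  next
    case (swap a b p)
    then have "(a, b) \<in> (adj_rel E)\<^sup>*"
      using assms(1) by (simp add: connected_graph_def)
    moreover have "\<exists>Ms. routes E (p \<circ> transpose a b \<circ> transpose a b) Ms"
      using swap by (simp only: comp_assoc transpose_comp_involutory comp_id)
    ultimately show ?case by (rule routable_transpose)
  qed
qed

lemma OPT_attained:
  assumes "connected_graph V E" and "C permutes V"
  obtains Ms where "length Ms = OPT E C" and "routes E C Ms"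
proof -
  have "\<exists>k Ms. length Ms = k \<and> routes E C Ms"
    using routable_connected[OF assms] by blast
  then have "\<exists>Ms. length Ms = OPT E C \<and> routes E C Ms"
    unfolding OPT_def by (rule LeastI_ex)
  then show thesis using that by blast
qed

lemma OPT_le: "routes E C Ms \<Longrightarrow> OPT E C \<le> length Ms"
  unfolding OPT_def by (rule Least_le) blast

subsection \<open>Complete bipartite graphs\<close>

text \<open>Covers both witness graphs: the star is the case of a singleton side.\<close>

definition complete_bipartite :: "'a set \<Rightarrow> 'a set \<Rightarrow> 'a set set" where
  "complete_bipartite A B = {{a, b} | a b. a \<in> A \<and> b \<in> B}"

lemma doubleton_in_complete_bipartite:
  "{x, y} \<in> complete_bipartite A B \<longleftrightarrow> x \<in> A \<and> y \<in> B \<or> y \<in> A \<and> x \<in> B"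
  unfolding complete_bipartite_def by (auto simp: doubleton_eq_iff)

lemma connected_complete_bipartite:
  assumes "finite A" "finite B" "A \<inter> B = {}" "A \<noteq> {}" "B \<noteq> {}"
  shows "connected_graph (A \<union> B) (complete_bipartite A B)"
proof -
  obtain a b where ab: "a \<in> A" "b \<in> B" using assms by blast
  let ?R = "adj_rel (complete_bipartite A B)"
  have R: "(x, y) \<in> ?R \<longleftrightarrow> x \<in> A \<and> y \<in> B \<or> y \<in> A \<and> x \<in> B" for x y
    by (simp add: adj_rel_def doubleton_in_complete_bipartite)
  have to: "(u, a) \<in> ?R\<^sup>*" if "u \<in> A \<union> B" for u
  proof (cases "u \<in> A")
    case True
    then have "(u, b) \<in> ?R" "(b, a) \<in> ?R" using ab R by auto
    then show ?thesis by (meson r_into_rtrancl rtrancl_trans)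
  next
    case False
    then have "(u, a) \<in> ?R" using that ab R by auto
    then show ?thesis by blast
  qed
  have "sym ?R" by (auto simp: sym_def R)
  from symD[OF sym_rtrancl[OF this] to]
  have from_a: "(a, u) \<in> ?R\<^sup>*" if "u \<in> A \<union> B" for u
    using that .
  have "card e = 2 \<and> e \<subseteq> A \<union> B" if e: "e \<in> complete_bipartite A B" for e
  proof -
    obtain x y where "e = {x, y}" "x \<in> A" "y \<in> B"
      using e unfolding complete_bipartite_def by blast
    moreover have "x \<noteq> y" using calculation assms(3) by blast
    ultimately show ?thesis by auto
  qed
  moreover have "(u, v) \<in> ?R\<^sup>*" if "u \<in> A \<union> B" "v \<in> A \<union> B" for u v
    using rtrancl_trans[OF to from_a] that .
  ultimately show ?thesis
    unfolding connected_graph_def simple_graph_def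
    using assms by simp
qed

lemma graph_dist_self: "graph_dist E u u = 0"
  unfolding graph_dist_def by (rule Least_eq_0) simp

text \<open>Any vertex of the opposite side is a common neighbour, while distinctness rules out
  length 0 and lying on the same side rules out length 1.\<close>

lemma graph_dist_complete_bipartite:
  assumes "A \<inter> B = {}" "A \<noteq> {}" "B \<noteq> {}"
    and "x \<noteq> y" and "x \<in> A \<and> y \<in> A \<or> x \<in> B \<and> y \<in> B"
  shows "graph_dist (complete_bipartite A B) x y = 2"
  unfolding graph_dist_def
proof (rule Least_equality)
  let ?R = "adj_rel (complete_bipartite A B)"
  have R: "(x, y) \<in> ?R \<longleftrightarrow> x \<in> A \<and> y \<in> B \<or> y \<in> A \<and> x \<in> B" for x y
    by (simp add: adj_rel_def doubleton_in_complete_bipartite)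
  obtain z where "(x, z) \<in> ?R" "(z, y) \<in> ?R"
    using assms R by blast
  then show "(x, y) \<in> ?R ^^ 2" by (auto simp: numeral_2_eq_2)
  fix k assume k: "(x, y) \<in> ?R ^^ k"
  have "k \<noteq> 0" using k \<open>x \<noteq> y\<close> by (intro notI) simp
  moreover have "k \<noteq> 1" using k assms R by auto
  ultimately show "2 \<le> k" by simp
qed

subsection \<open>Routing on a star\<close>

text \<open>All edges contain \<open>c\<close>, so no two different ones are disjoint.\<close>

lemma matching_star:
  assumes "matching (complete_bipartite {c} B) M"
  shows "M = {} \<or> (\<exists>b. M = {{c, b}})"
proof -
  have *: "\<exists>b. e = {c, b}" if "e \<in> M" for e
    using assms that by (auto simp: matching_def complete_bipartite_def)
  have "e = e'" if "e \<in> M" "e' \<in> M" for e e'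
  proof -
    have "c \<in> e \<inter> e'" using *[OF that(1)] *[OF that(2)] by auto
    then show ?thesis
      using assms that by (auto simp: matching_def disjoint_def)
  qed
  then show ?thesis using * by blast
qed

text \<open>Each step alters the tokens on at most two vertices, and no vertex is displaced at the
  end. Finiteness is carried through the induction because \<open>card\<close> is 0 on infinite
  sets.\<close>

lemma displaced_le_star_routing:
  assumes "routes (complete_bipartite {c} B) C Ms"
  shows "finite {x. C x \<noteq> x} \<and> card {x. C x \<noteq> x} \<le> 2 * length Ms"
  using assms
proof (induction Ms arbitrary: C)
  case Nil
  then show ?case by (simp add: routes_def)
next
  case (Cons M Ms)
  let ?D = "{x. apply_matching M C x \<noteq> x}"
  have IH: "finite ?D" "card ?D \<le> 2 * length Ms"
    using Cons by (auto simp: routes_Cons)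
  have "M = {} \<or> (\<exists>b. M = {{c, b}})"
    using Cons.prems matching_star routes_Cons by metis
  then obtain b where "\<Union>M \<subseteq> {c, b}" by auto
  then have sub: "{x. C x \<noteq> x} \<subseteq> ?D \<union> {c, b}"
    by (auto simp: apply_matching_def)
  have "card {x. C x \<noteq> x} \<le> card (?D \<union> {c, b})"
    using sub IH by (intro card_mono) auto
  also have "\<dots> \<le> card ?D + card {c, b}" by (rule card_Un_le)
  also have "card {c, b} \<le> 2" by (simp add: card_insert_if)
  finally have "card {x. C x \<noteq> x} \<le> 2 * length (M # Ms)"
    using IH by simp
  moreover have "finite {x. C x \<noteq> x}"
    using IH by (intro finite_subset[OF sub]) simp
  ultimately show ?case by blast
qed

subsection \<open>The common configuration\<close>

text \<open>For \<open>k < 4\<close> only the two lowest bits change, so each block of four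
  consecutive numbers starting at a multiple of 4 is preserved. Block 0 stays fixed: it contains 0,
  which is no vertex, and 1, the centre of the star. With \<open>m = (n + 1) div 4\<close> the last
  block ends at \<open>4 * m - 1 \<le> n\<close>.\<close>

definition block_xor :: "nat \<Rightarrow> nat \<Rightarrow> nat \<Rightarrow> nat" where
  "block_xor m k x = (if x div 4 \<in> {1..<m} then xor x k else x)"

lemma div_4_xor: "k < 4 \<Longrightarrow> xor x k div 4 = x div 4" for x k :: nat
proof -
  assume "k < 4"
  then have "drop_bit 2 k = 0" by (simp add: drop_bit_eq_div)
  then have "drop_bit 2 (xor x k) = drop_bit 2 x" by (simp add: drop_bit_xor)
  then show ?thesis by (simp add: drop_bit_eq_div)
qed

lemma xor_eq_self_iff: "xor x k = x \<longleftrightarrow> k = 0" for x k :: nat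
  by (metis xor.assoc xor_self_eq xor.left_neutral xor.right_neutral)

text \<open>Blocks are preserved, so the maps with indices below 4 compose like the Klein
  four-group.\<close>

lemma block_xor_block_xor:
  assumes "k < 4"
  shows "block_xor m j (block_xor m k x) = block_xor m (xor k j) x"
  using assms by (simp add: block_xor_def div_4_xor xor.assoc)

lemma block_xor_0: "block_xor m 0 x = x"
  by (simp add: block_xor_def)

lemma block_xor_neq_iff: "k \<noteq> 0 \<Longrightarrow> block_xor m k x \<noteq> x \<longleftrightarrow> x div 4 \<in> {1..<m}"
  by (simp add: block_xor_def xor_eq_self_iff)

lemma block_xor_involution: "k < 4 \<Longrightarrow> block_xor m k (block_xor m k x) = x"
  by (simp add: block_xor_block_xor block_xor_0)

lemma block_subset: "x div 4 \<in> {1..<(n + 1) div 4} \<Longrightarrow> x \<in> {4..n}" for x n :: nat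
  by (simp, linarith)

lemma block_xor_in_block:
  assumes "k < 4" "k \<noteq> 0" "block_xor ((n + 1) div 4) k x \<noteq> x"
  shows "x \<in> {4..n}" "block_xor ((n + 1) div 4) k x \<in> {4..n}"
  using assms block_subset by (auto simp: block_xor_neq_iff block_xor_def div_4_xor split: if_splits)

lemma block_xor_permutes:
  assumes "k < 4" "k \<noteq> 0"
  shows "block_xor ((n + 1) div 4) k permutes {1..n}"
  unfolding permutes_def
proof (intro conjI allI impI)
  show "block_xor ((n + 1) div 4) k x = x" if "x \<notin> {1..n}" for x
    using block_xor_in_block(1)[OF assms, of n x] that by fastforce
  show "\<exists>!x. block_xor ((n + 1) div 4) k x = y" for y
    using block_xor_involution[OF assms(1)] by metis
qed

lemma card_blocks: "card {x. x div 4 \<in> {1..<m}} = 4 * (m - 1)" for m :: nat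
proof -
  have "{x. x div 4 \<in> {1..<m}} = {4..<4 * m}" by (intro set_eqI, simp, linarith)
  then show ?thesis by simp
qed

text \<open>Index 2 keeps every vertex on its side of the even-odd bipartition, whereas indices 1
  and 3 send each moved vertex across an edge.\<close>

lemma even_block_xor_iff:
  "x div 4 \<in> {1..<m} \<Longrightarrow> even (block_xor m k x) \<longleftrightarrow> (even x \<longleftrightarrow> even k)"
  by (auto simp: block_xor_def even_xor_iff)

section \<open>Token distances and optima on the two graphs\<close>

lemma token_dist_complete_bipartite:
  fixes C :: "'a \<Rightarrow> 'a"
  assumes "A \<inter> B = {}" "A \<noteq> {}" "B \<noteq> {}"
    and inv: "\<And>x. C (C x) = x"
    and same: "\<And>x. C x \<noteq> x \<Longrightarrow> C x \<in> A \<and> x \<in> A \<or> C x \<in> B \<and> x \<in> B"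
  shows "token_dist (complete_bipartite A B) C t = (if C t = t then 0 else 2)"
proof -
  have "inv C = C" using inv by (simp add: inv_equality)
  then show ?thesis
    using graph_dist_complete_bipartite[OF assms(1-3), of "C t" t] same[of t]
    by (simp add: token_dist_def graph_dist_self)
qed

lemma OPT_bipartite_le:
  fixes n :: nat
  assumes "A = {x \<in> {1..n}. even x}" "B = {x \<in> {1..n}. odd x}"
  shows "OPT (complete_bipartite A B) (block_xor ((n + 1) div 4) 2) \<le> 2"
proof -
  let ?b = "block_xor ((n + 1) div 4)" and ?E = "complete_bipartite A B"
  have inv: "?b k (?b k x) = x" if "k < 4" for k x
    using that by (rule block_xor_involution)
  have matching: "matching ?E (involution_matching (?b k))" if "k < 4" "odd k" for k
  proof (rule matching_involution_matching)
    fix x assume neq: "?b k x \<noteq> x"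
    have "k \<noteq> 0" using that(2) by (intro notI) simp
    then have "x \<in> {4..n}" "?b k x \<in> {4..n}" "even (?b k x) \<longleftrightarrow> odd x"
      using that neq block_xor_in_block[of k n x] even_block_xor_iff[of x]
      by (auto simp: block_xor_neq_iff)
    then show "{x, ?b k x} \<in> ?E"
      unfolding doubleton_in_complete_bipartite assms by auto
  qed (use inv that in blast)
  \<comment> \<open>The indices 1, 3 and 2 have xor 0. Each applied matching composes on the right,
    so the head of the list, with index 3, stands next to \<open>?b 2\<close>.\<close>
  have "?b 2 \<circ> ?b 3 \<circ> ?b 1 = id"
    by (simp add: fun_eq_iff block_xor_block_xor block_xor_0)
  then have "routes ?E (?b 2) [involution_matching (?b 3), involution_matching (?b 1)]"
    using matching[of 3] matching[of 1] inv
    by (simp add: routes_def apply_involution_matching)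
  from OPT_le[OF this] show ?thesis by simp
qed

text \<open>The left side counts the displaced vertices, four in each block except block 0; an
  optimal routing repairs at most two per step.\<close>

lemma star_le_OPT:
  assumes "n \<ge> 2"
  shows "4 * ((n + 1) div 4 - 1) \<le>
    2 * OPT (complete_bipartite {1} {2..n}) (block_xor ((n + 1) div 4) 2)"
proof -
  let ?C = "block_xor ((n + 1) div 4) 2" and ?E = "complete_bipartite {1} {2..n}"
  have "{1} \<union> {2..n} = {1..n}" using assms by auto
  then have "connected_graph {1..n} ?E"
    using connected_complete_bipartite[of "{1}" "{2..n}"] assms by simp
  moreover have "?C permutes {1..n}" by (rule block_xor_permutes) auto
  ultimately obtain Ms where Ms: "length Ms = OPT ?E ?C" "routes ?E ?C Ms"
    by (rule OPT_attained)
  have "{x. ?C x \<noteq> x} = {x. x div 4 \<in> {1..<(n + 1) div 4}}"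
    by (simp add: block_xor_neq_iff)
  then show ?thesis
    using displaced_le_star_routing[OF Ms(2)] Ms(1) by (simp only: card_blocks)
qed

theorem theorem1:
  fixes f :: "nat \<Rightarrow> nat list \<Rightarrow> real"
  assumes "valid_lower_bound f"
  shows "\<exists>c::real. c > 0 \<and> (\<exists>n0::nat. \<forall>n\<ge>n0. stretch_factor f n \<ge> ereal (c * real n))"
proof (intro exI conjI allI impI)
  \<comment> \<open>The constant comes from an optimum of at least \<open>n / 4\<close> on the star
    and a bound \<open>f\<close> of at most 2.\<close>
  show "(1 / 8 :: real) > 0" by simp
  fix n :: nat assume n: "12 \<le> n"
  let ?C = "block_xor ((n + 1) div 4) 2"
  let ?A = "{x \<in> {1..n}. even x}" and ?B = "{x \<in> {1..n}. odd x}"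
  let ?K = "complete_bipartite ?A ?B" and ?S = "complete_bipartite {1} {2..n}"
  have perm: "?C permutes {1..n}" by (rule block_xor_permutes) auto
  have inv: "?C (?C x) = x" for x by (rule block_xor_involution) simp
  have AB: "?A \<inter> ?B = {}" "?A \<noteq> {}" "?B \<noteq> {}" "?A \<union> ?B = {1..n}"
  proof -
    have "2 \<in> ?A" "1 \<in> ?B" using n by auto
    then show "?A \<noteq> {}" "?B \<noteq> {}" by blast+
  qed auto
  have S: "{1} \<inter> {2..n} = {}" "{1} \<union> {2..n} = {1..n}" "{2..n} \<noteq> {}"
    using n by auto
  have "connected_graph {1..n} ?K"
    using connected_complete_bipartite[of ?A ?B] AB by simp
  then have instK: "(?K, ?C) \<in> instances n" using perm by (simp add: instances_def)
  have "connected_graph {1..n} ?S"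
    using connected_complete_bipartite[of "{1}" "{2..n}"] S by simp
  then have instS: "(?S, ?C) \<in> instances n" using perm by (simp add: instances_def)
  have moved: "?C x \<in> {4..n}" "x \<in> {4..n}" "even (?C x) = even x" if "?C x \<noteq> x" for x
    using that block_xor_in_block[of 2 n x] even_block_xor_iff[of x]
    by (auto simp: block_xor_neq_iff)
  have "token_dist ?K ?C t = (if ?C t = t then 0 else 2)" for t
  proof (intro token_dist_complete_bipartite AB inv)
    show "?C x \<in> ?A \<and> x \<in> ?A \<or> ?C x \<in> ?B \<and> x \<in> ?B" if "?C x \<noteq> x" for x
      using moved[OF that] by simp
  qed
  moreover have "token_dist ?S ?C t = (if ?C t = t then 0 else 2)" for t
  proof (intro token_dist_complete_bipartite S inv)
    show "?C x \<in> {1} \<and> x \<in> {1} \<or> ?C x \<in> {2..n} \<and> x \<in> {2..n}" if "?C x \<noteq> x" for x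
      using moved[OF that] by simp
  qed simp
  \<comment> \<open>Both distances depend only on whether \<open>?C\<close> fixes the token, so
    \<open>f\<close> cannot tell the two graphs apart.\<close>
  ultimately have same: "dist_vector n ?K ?C = dist_vector n ?S ?C"
    by (simp add: dist_vector_def)
  have "f n (dist_vector n ?K ?C) \<le> real (OPT ?K ?C)"
    using assms instK n unfolding valid_lower_bound_def by (auto dest!: spec[of _ n])
  also have "\<dots> \<le> 2" using OPT_bipartite_le[OF refl refl, of n] by simp
  finally have f: "f n (dist_vector n ?S ?C) \<le> 2" unfolding same .
  have "n - 6 \<le> 4 * ((n + 1) div 4 - 1)" by linarith
  also have "\<dots> \<le> 2 * OPT ?S ?C" using n by (intro star_le_OPT) simp
  finally have "n - 6 \<le> 2 * OPT ?S ?C" .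
  \<comment> \<open>Here \<open>n \<ge> 12\<close> is used: it gives
    \<open>n - 6 \<ge> n / 2\<close>.\<close>
  then have opt: "real n / 4 \<le> real (OPT ?S ?C)" using n by linarith
  have "ereal (1 / 8 * real n) \<le> ratio (OPT ?S ?C) (f n (dist_vector n ?S ?C))"
  \<comment> \<open>A nonpositive bound makes the ratio infinite; otherwise dividing by a positive
    number at most 2 gives \<open>n / 8\<close>.\<close>
  proof (cases "f n (dist_vector n ?S ?C) \<le> 0")
    case False
    have "real n / 4 / 2 \<le> real (OPT ?S ?C) / f n (dist_vector n ?S ?C)"
      using opt f False by (intro frac_le) auto
    then show ?thesis using False by (simp add: ratio_def)
  qed (simp add: ratio_def)
  moreover have "?C \<noteq> id"
  proof -
    have "?C 4 \<noteq> 4" using n by (subst block_xor_neq_iff) auto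
    then show ?thesis by auto
  qed
  ultimately show "ereal (1 / 8 * real n) \<le> stretch_factor f n"
    unfolding stretch_factor_def using instS by (intro SUP_upper2[of "(?S, ?C)"]) auto
qed

end
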